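(* Let $n\ge 1$, let $z\in\mathbb{C}^n_1$, let $\Delta\in\mathbb{C}^{n\times n}$ be Hermitian, and let $C=zz^*+\Delta$. Suppose $\|\Delta\|_{\mathrm{op}}\le \frac{1}{28}n^{2/3}$ and $\|\Delta z\|_\infty\le\frac{1}{28}n^{2/3}\sqrt{\log n}$. Let $\alpha\ge 0$ be such that $C+\alpha I_n\succeq 0$ and $\alpha\le\|\Delta\|_{\mathrm{op}}$. Let $(x_k)_{k=0,1,2,\ldots}$ be the iterates of the generalized power method (GPM) with parameter $\alpha$, initialized at an eigenvector estimator $x_0=\hat v$ of $C$. Then the optimization problem $\max_{x\in\mathbb{C}^n_1}x^*Cx$ has a unique global optimum up to phase (i.e., its set of global optima is a single equivalence class of $\sim$), and the equivalence classes $[x_k]$ converge to this class in the quotient space $\mathbb{C}^n_1/\!\sim$; equivalently, $d(x_{\mathrm{opt}},x_k)\to 0$ as $k\to\infty$ for any global optimum $x_{\mathrm{opt}}$.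
   Context: $\mathbb{C}^n_1=\{x\in\mathbb{C}^n:|x_1|=\cdots=|x_n|=1\}$. $\|\cdot\|_{\mathrm{op}}$ is the operator norm (largest singular value), $\|\cdot\|_p$ is the $\ell_p$-norm of a vector, $*$ denotes conjugate transpose, $\log$ is the natural logarithm. Equivalence: for $x,y\in\mathbb{C}^n_1$, $x\sim y$ iff $x=ye^{i\theta}$ for some $\theta\in\mathbb{R}$; $[x]$ is the class of $x$. The distance on the quotient is $d(x,y)=\min_{\theta\in\mathbb{R}}\|ye^{i\theta}-x\|_2=\sqrt{2(n-|x^*y|)}$. Eigenvector estimator: let $v\in\mathbb{C}^n$ be an eigenvector of $C$ associated with its largest eigenvalue, scaled so that $\|v\|_2^2=n$, and let $e\in\mathbb{C}^n$ be an arbitrary vector with $e^*v\neq0$. Then $\hat v\in\mathbb{C}^n_1$ is given by $\hat v_i=v_i/|v_i|$ if $v_i\ne0$ and $\hat v_i=e^*v/|e^*v|$ otherwise. GPM with parameter $\alpha\ge0$ such that $\tilde C:=C+\alpha I_n\succeq 0$: starting from $x_0$, iterate $x_{k+1}=T(x_k)$ for $k=0,1,2,\ldots$, where $T:\mathbb{C}^n_1\to\mathbb{C}^n_1$ is $T(x)_i=(\tilde Cx)_i/|(\tilde Cx)_i|$ if $(\tilde Cx)_i\ne0$ and $T(x)_i=x_i$ otherwise. *)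

theory Defs
  imports "HOL-Analysis.Analysis"
begin

text \<open>
  The library inner product on \<^typ>\<open>complex ^ 'n\<close> is the real one; this is
  \<open>x\<^sup>* y\<close>, conjugate-linear in the first argument.
\<close>
definition cinner :: "complex ^ 'n \<Rightarrow> complex ^ 'n \<Rightarrow> complex" where
  "cinner x y = (\<Sum>i\<in>UNIV. cnj (x $ i) * y $ i)"

definition conj_transpose :: "complex ^ 'n ^ 'm \<Rightarrow> complex ^ 'm ^ 'n" where
  "conj_transpose A = (\<chi> i j. cnj (A $ j $ i))"

definition hermitian :: "complex ^ 'n ^ 'n \<Rightarrow> bool" where
  "hermitian A \<longleftrightarrow> conj_transpose A = A"

definition outer :: "complex ^ 'n \<Rightarrow> complex ^ 'n \<Rightarrow> complex ^ 'n ^ 'n" where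
  "outer x y = (\<chi> i j. x $ i * cnj (y $ j))"

definition psd :: "complex ^ 'n ^ 'n \<Rightarrow> bool" where
  "psd A \<longleftrightarrow> hermitian A \<and> (\<forall>x. Re (cinner x (A *v x)) \<ge> 0)"

definition op_norm :: "complex ^ 'n ^ 'm \<Rightarrow> real" where
  "op_norm A = onorm (\<lambda>x. A *v x)"

text \<open>
  Not the library's \<^const>\<open>infnorm\<close>, which on \<^typ>\<open>complex ^ 'n\<close> takes the maximum over
  real and imaginary parts separately.
\<close>
definition linf_norm :: "complex ^ 'n \<Rightarrow> real" where
  "linf_norm x = (MAX i. norm (x $ i))"

definition eigenpair :: "complex ^ 'n ^ 'n \<Rightarrow> complex \<Rightarrow> complex ^ 'n \<Rightarrow> bool" where
  "eigenpair A l v \<longleftrightarrow> v \<noteq> 0 \<and> A *v v = l *s v"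

text \<open>Intended for Hermitian matrices, all of whose eigenvalues are real.\<close>
definition largest_eigenvalue :: "complex ^ 'n ^ 'n \<Rightarrow> real \<Rightarrow> bool" where
  "largest_eigenvalue A l \<longleftrightarrow>
     (\<exists>v. eigenpair A (of_real l) v) \<and> (\<forall>m v. eigenpair A m v \<longrightarrow> Re m \<le> l)"

definition torus :: "(complex ^ 'n) set" where
  "torus = {x. \<forall>i. norm (x $ i) = 1}"

definition phase_rel :: "((complex ^ 'n) \<times> (complex ^ 'n)) set" where
  "phase_rel = {(x, y). x \<in> torus \<and> y \<in> torus \<and> (\<exists>\<theta>::real. x = cis \<theta> *s y)}"

text \<open>The infimum is attained: see \<open>phase_dist_attained\<close> and \<open>phase_dist_eq\<close> below.\<close>
definition phase_dist :: "complex ^ 'n \<Rightarrow> complex ^ 'n \<Rightarrow> real" where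
  "phase_dist x y = (INF \<theta>::real. norm (cis \<theta> *s y - x))"

text \<open>Independent of the choice of representatives: see \<open>quot_dist_class\<close> below.\<close>
definition quot_dist :: "(complex ^ 'n) set \<Rightarrow> (complex ^ 'n) set \<Rightarrow> real" where
  "quot_dist X Y = phase_dist (SOME x. x \<in> X) (SOME y. y \<in> Y)"

definition quot_topology :: "(complex ^ 'n) set topology" where
  "quot_topology = Metric_space.mtopology (torus // phase_rel) quot_dist"

text \<open>
  For Hermitian \<open>C\<close> the objective \<open>x\<^sup>* C x\<close> is real, so taking the real part is harmless.
\<close>
definition global_optima :: "complex ^ 'n ^ 'n \<Rightarrow> (complex ^ 'n) set" where
  "global_optima C = {x. is_arg_max (\<lambda>x. Re (cinner x (C *v x))) (\<lambda>x. x \<in> torus) x}"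

definition eig_round :: "complex ^ 'n \<Rightarrow> complex ^ 'n \<Rightarrow> complex ^ 'n" where
  "eig_round e v = (\<chi> i. if v $ i \<noteq> 0 then v $ i / of_real (norm (v $ i))
                          else cinner e v / of_real (norm (cinner e v)))"

definition eig_estimator :: "complex ^ 'n ^ 'n \<Rightarrow> complex ^ 'n \<Rightarrow> bool" where
  "eig_estimator C x \<longleftrightarrow>
     (\<exists>l v e. largest_eigenvalue C l \<and> eigenpair C (of_real l) v
        \<and> (norm v)\<^sup>2 = real CARD('n) \<and> cinner e v \<noteq> 0 \<and> x = eig_round e v)"

definition gpm_step :: "complex ^ 'n ^ 'n \<Rightarrow> real \<Rightarrow> complex ^ 'n \<Rightarrow> complex ^ 'n" where
  "gpm_step C \<alpha> x =
     (let w = (C + mat (of_real \<alpha>)) *v x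
      in \<chi> i. if w $ i \<noteq> 0 then w $ i / of_real (norm (w $ i)) else x $ i)"

definition gpm :: "complex ^ 'n ^ 'n \<Rightarrow> real \<Rightarrow> complex ^ 'n \<Rightarrow> nat \<Rightarrow> complex ^ 'n" where
  "gpm C \<alpha> x0 k = (gpm_step C \<alpha> ^^ k) x0"

lemma cinner_hermitian_real:
  assumes "hermitian A"
  shows "cinner x (A *v x) \<in> \<real>"
proof -
  have A: "cnj (A $ i $ j) = A $ j $ i" for i j
    using arg_cong[OF assms[unfolded hermitian_def], of "\<lambda>M. M $ j $ i"]
    by (simp add: conj_transpose_def)
  have "cnj (cinner x (A *v x)) = (\<Sum>i\<in>UNIV. \<Sum>j\<in>UNIV. x $ i * (A $ j $ i * cnj (x $ j)))"
    by (simp add: cinner_def matrix_vector_mult_def sum_distrib_left A)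
  also have "\<dots> = (\<Sum>j\<in>UNIV. \<Sum>i\<in>UNIV. x $ i * (A $ j $ i * cnj (x $ j)))"
    by (rule sum.swap)
  also have "\<dots> = cinner x (A *v x)"
    by (simp add: cinner_def matrix_vector_mult_def sum_distrib_left mult_ac)
  finally show ?thesis
    by (simp add: Reals_cnj_iff)
qed

lemma norm_cis_scale [simp]: "norm (cis \<theta> *s (x :: complex ^ 'n)) = norm x"
  by (simp add: norm_vec_def norm_mult)

lemma cis_scale_torus [simp]: "cis \<theta> *s x \<in> torus \<longleftrightarrow> x \<in> torus"
  by (simp add: torus_def norm_mult)

lemma norm_sq_torus: "x \<in> torus \<Longrightarrow> (norm (x :: complex ^ 'n))\<^sup>2 = real CARD('n)"
  by (simp add: torus_def norm_vec_def L2_set_def)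

lemma equiv_phase_rel: "equiv torus (phase_rel :: ((complex ^ 'n) \<times> (complex ^ 'n)) set)"
proof (rule equivI)
  show "phase_rel \<subseteq> torus \<times> torus"
    by (auto simp: phase_rel_def)
  show "refl_on torus (phase_rel :: ((complex ^ 'n) \<times> (complex ^ 'n)) set)"
    by (auto simp: phase_rel_def refl_on_def intro!: exI[of _ 0])
  show "sym (phase_rel :: ((complex ^ 'n) \<times> (complex ^ 'n)) set)"
  proof (rule symI)
    fix x y :: "complex ^ 'n"
    assume "(x, y) \<in> phase_rel"
    then obtain \<theta> where "x \<in> torus" "y \<in> torus" "x = cis \<theta> *s y"
      by (auto simp: phase_rel_def)
    moreover have "y = cis (- \<theta>) *s x"
      using \<open>x = _\<close> by (simp add: cis_mult)
    ultimately show "(y, x) \<in> phase_rel"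
      unfolding phase_rel_def by blast
  qed
  show "trans (phase_rel :: ((complex ^ 'n) \<times> (complex ^ 'n)) set)"
    by (rule transI) (auto simp: phase_rel_def cis_mult)
qed

lemma phase_dist_bdd: "bdd_below (range (\<lambda>\<theta>::real. norm (cis \<theta> *s y - x)))"
  by (rule bdd_belowI[of _ 0]) auto

lemma phase_dist_nonneg: "phase_dist x y \<ge> 0"
  unfolding phase_dist_def by (rule cINF_greatest) auto

lemma phase_dist_le: "phase_dist x y \<le> norm (cis \<theta> *s y - x)"
  unfolding phase_dist_def by (rule cINF_lower[OF phase_dist_bdd]) simp

lemma phase_dist_commute: "phase_dist x y = phase_dist y (x :: complex ^ 'n)"
proof -
  have *: "phase_dist x y \<le> phase_dist y x" for x y :: "complex ^ 'n"
  proof -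
    have "phase_dist x y \<le> norm (cis \<theta> *s x - y)" for \<theta>
    proof -
      have "phase_dist x y \<le> norm (cis (- \<theta>) *s y - x)"
        by (rule phase_dist_le)
      also have "\<dots> = norm (cis \<theta> *s (cis (- \<theta>) *s y - x))"
        by (simp only: norm_cis_scale)
      also have "\<dots> = norm (y - cis \<theta> *s x)"
        by (simp add: cis_mult vector_ssub_ldistrib)
      finally show ?thesis
        by (simp add: norm_minus_commute)
    qed
    then show ?thesis
      unfolding phase_dist_def[of y x] by (intro cINF_greatest) auto
  qed
  show ?thesis
    using *[of x y] *[of y x] by simp
qed

lemma norm_phase_diff_sq:
  assumes "x \<in> torus" "y \<in> torus"
  shows "(norm (cis \<theta> *s y - (x :: complex ^ 'n)))\<^sup>2
         = 2 * (real CARD('n) - Re (cis \<theta> * cinner x y))"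
proof -
  have *: "(norm (cis \<theta> * y $ i - x $ i))\<^sup>2 = 2 - 2 * Re (cis \<theta> * (cnj (x $ i) * y $ i))" for i
  proof -
    define w where "w = cis \<theta> * y $ i"
    have "norm w = 1" "norm (x $ i) = 1"
      using assms by (auto simp: w_def torus_def norm_mult)
    then have "(Re w)\<^sup>2 + (Im w)\<^sup>2 = 1" "(Re (x $ i))\<^sup>2 + (Im (x $ i))\<^sup>2 = 1"
      by (simp_all add: cmod_def)
    then have "(norm (w - x $ i))\<^sup>2 = 2 - 2 * Re (cnj (x $ i) * w)"
      by (simp add: cmod_power2 power2_diff algebra_simps)
    then show ?thesis
      by (simp add: w_def mult_ac)
  qed
  have "(norm (cis \<theta> *s y - x))\<^sup>2 = (\<Sum>i\<in>UNIV. (norm (cis \<theta> * y $ i - x $ i))\<^sup>2)"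
    by (simp add: norm_vec_def L2_set_def sum_nonneg)
  also have "\<dots> = 2 * (real CARD('n) - Re (cis \<theta> * cinner x y))"
    unfolding * by (simp add: cinner_def sum_subtractf sum_distrib_left Re_sum del: times_complex.sel)
  finally show ?thesis .
qed

lemma phase_dist_attained_eq:
  assumes "x \<in> torus" "y \<in> torus"
  obtains \<theta> where "phase_dist x y = norm (cis \<theta> *s y - (x :: complex ^ 'n))"
    and "norm (cis \<theta> *s y - x) = sqrt (2 * (real CARD('n) - norm (cinner x y)))"
proof -
  let ?s = "sqrt (2 * (real CARD('n) - norm (cinner x y)))"
  have eq: "norm (cis \<theta> *s y - x) = sqrt (2 * (real CARD('n) - Re (cis \<theta> * cinner x y)))" for \<theta>
    unfolding norm_phase_diff_sq[OF assms, symmetric] by simp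
  define \<theta> where "\<theta> = - Arg (cinner x y)"
  have "cis \<theta> * cinner x y = of_real (norm (cinner x y))"
  proof -
    have "cis \<theta> * cinner x y = cis \<theta> * rcis (norm (cinner x y)) (Arg (cinner x y))"
      by (simp add: rcis_cmod_Arg)
    also have "\<dots> = of_real (norm (cinner x y)) * (cis \<theta> * cis (Arg (cinner x y)))"
      by (simp add: rcis_def mult_ac)
    finally show ?thesis
      by (simp add: \<theta>_def cis_mult)
  qed
  then have 1: "norm (cis \<theta> *s y - x) = ?s"
    unfolding eq by simp
  have "?s \<le> norm (cis t *s y - x)" for t
  proof -
    have "Re (cis t * cinner x y) \<le> norm (cis t * cinner x y)"
      by (rule complex_Re_le_cmod)
    also have "\<dots> = norm (cinner x y)"
      by (simp add: norm_mult)
    finally show ?thesis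
      unfolding eq by (intro real_sqrt_le_mono mult_left_mono diff_left_mono) simp_all
  qed
  then have "?s \<le> phase_dist x y"
    unfolding phase_dist_def by (intro cINF_greatest) auto
  with phase_dist_le[of x y \<theta>] 1 show ?thesis
    by (intro that[of \<theta>]) auto
qed

lemma phase_dist_attained:
  assumes "x \<in> torus" "y \<in> torus"
  shows "\<exists>\<theta>. phase_dist x y = norm (cis \<theta> *s y - x)"
  using phase_dist_attained_eq[OF assms] by metis

lemma phase_dist_eq:
  assumes "x \<in> torus" "y \<in> torus"
  shows "phase_dist x (y :: complex ^ 'n) = sqrt (2 * (real CARD('n) - norm (cinner x y)))"
  using phase_dist_attained_eq[OF assms] by metis

lemma phase_dist_triangle:
  assumes "x \<in> torus" "y \<in> torus" "z \<in> torus"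
  shows "phase_dist x z \<le> phase_dist x y + phase_dist y (z :: complex ^ 'n)"
proof -
  obtain a where a: "phase_dist x y = norm (cis a *s y - x)"
    using phase_dist_attained assms by blast
  obtain b where b: "phase_dist y z = norm (cis b *s z - y)"
    using phase_dist_attained assms by blast
  have "phase_dist x z \<le> norm (cis (a + b) *s z - x)"
    by (rule phase_dist_le)
  also have "cis (a + b) *s z - x = cis a *s (cis b *s z - y) + (cis a *s y - x)"
    by (simp add: cis_mult vector_ssub_ldistrib)
  also have "norm \<dots> \<le> norm (cis a *s (cis b *s z - y)) + norm (cis a *s y - x)"
    by (rule norm_triangle_ineq)
  finally show ?thesis
    by (simp only: norm_cis_scale a b add.commute)
qed

lemma phase_dist_zero_iff:
  assumes "x \<in> torus" "y \<in> torus"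
  shows "phase_dist x y = 0 \<longleftrightarrow> (x, y) \<in> phase_rel"
proof
  assume "phase_dist x y = 0"
  with phase_dist_attained[OF assms] obtain \<theta> where "norm (cis \<theta> *s y - x) = 0"
    by auto
  then have "x = cis \<theta> *s y"
    by simp
  with assms show "(x, y) \<in> phase_rel"
    unfolding phase_rel_def by blast
next
  assume "(x, y) \<in> phase_rel"
  then obtain \<theta> where "x = cis \<theta> *s y"
    by (auto simp: phase_rel_def)
  with phase_dist_le[of x y \<theta>] phase_dist_nonneg[of x y] show "phase_dist x y = 0"
    by simp
qed

lemma phase_dist_cong:
  assumes "(x, x') \<in> phase_rel" "(y, y') \<in> phase_rel"
  shows "phase_dist x y = phase_dist x' y'"
proof -
  have *: "phase_dist x y \<le> phase_dist x' y'"
    if "(x, x') \<in> phase_rel" "(y, y') \<in> phase_rel" for x x' y y' :: "complex ^ 'n"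
  proof -
    have t: "x \<in> torus" "x' \<in> torus" "y \<in> torus" "y' \<in> torus"
      using that by (auto simp: phase_rel_def)
    have "phase_dist x x' = 0" "phase_dist y y' = 0"
      using that t by (auto simp: phase_dist_zero_iff)
    then show ?thesis
      using phase_dist_triangle[OF t(1,2,3)] phase_dist_triangle[OF t(2,4,3)]
      by (simp add: phase_dist_commute[of y' y])
  qed
  have "(x', x) \<in> phase_rel" "(y', y) \<in> phase_rel"
    using assms equivE[OF equiv_phase_rel] by (meson symD)+
  with * assms show ?thesis
    by (meson order_antisym)
qed

lemma quot_dist_rep:
  assumes "X \<in> torus // phase_rel" "Y \<in> torus // phase_rel" "x \<in> X" "y \<in> Y"
  shows "quot_dist X Y = phase_dist x y"
  unfolding quot_dist_def
proof (rule phase_dist_cong)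
  show "(SOME x. x \<in> X, x) \<in> phase_rel"
    by (rule quotient_eq_iff[OF equiv_phase_rel assms(1,1) someI[of _ x] assms(3), THEN iffD1])
      (use assms in auto)
  show "(SOME y. y \<in> Y, y) \<in> phase_rel"
    by (rule quotient_eq_iff[OF equiv_phase_rel assms(2,2) someI[of _ y] assms(4), THEN iffD1])
      (use assms in auto)
qed

lemma quot_dist_class:
  assumes "x \<in> torus" "y \<in> torus"
  shows "quot_dist (phase_rel `` {x}) (phase_rel `` {y}) = phase_dist x y"
  using assms by (intro quot_dist_rep quotientI equiv_class_self[OF equiv_phase_rel]) auto

lemma Metric_space_quot: "Metric_space (torus // phase_rel) quot_dist"
proof
  fix X Y :: "(complex ^ 'n) set"
  show "0 \<le> quot_dist X Y" "quot_dist X Y = quot_dist Y X"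
    by (simp_all add: quot_dist_def phase_dist_nonneg phase_dist_commute)
next
  fix X Y :: "(complex ^ 'n) set"
  assume XY: "X \<in> torus // phase_rel" "Y \<in> torus // phase_rel"
  then obtain x y where xy: "x \<in> torus" "y \<in> torus"
      and X: "X = phase_rel `` {x}" and Y: "Y = phase_rel `` {y}"
    by (auto elim!: quotientE)
  show "quot_dist X Y = 0 \<longleftrightarrow> X = Y"
    unfolding X Y quot_dist_class[OF xy] phase_dist_zero_iff[OF xy]
    using eq_equiv_class_iff[OF equiv_phase_rel xy] by blast
next
  fix X Y Z :: "(complex ^ 'n) set"
  assume "X \<in> torus // phase_rel" "Y \<in> torus // phase_rel" "Z \<in> torus // phase_rel"
  then obtain x y z where "x \<in> torus" "y \<in> torus" "z \<in> torus"
      "X = phase_rel `` {x}" "Y = phase_rel `` {y}" "Z = phase_rel `` {z}"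
    by (auto elim!: quotientE)
  then show "quot_dist X Z \<le> quot_dist X Y + quot_dist Y Z"
    by (simp add: quot_dist_class phase_dist_triangle)
qed

end

theory Submission
  imports Defs
begin

text \<open>
  The reason is that one step of the power method is a contraction, with factor \<open>6 / 7\<close> for the
  phase-invariant distance, on a neighbourhood of \<open>z\<close> that it maps into itself and that contains
  both the starting point and every global optimum. Write \<open>N\<close> for the dimension, \<open>D\<close> for the
  operator norm of \<open>\<Delta>\<close> and \<open>B = C + \<alpha> I\<close>. The neighbourhood (\<open>basin\<close>) is the set of points
  of the torus at distance at most \<open>8 D / sqrt N\<close> from the class of \<open>z\<close>.

  \<^item> A vector of norm \<open>sqrt N\<close> whose objective is at least that of \<open>z\<close> lies, after a rotation,
    within \<open>3 D / sqrt N\<close> of \<open>z\<close> (\<open>near_truth_if_objective_ge\<close>): the rank-one part of the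
    objective punishes deviation from \<open>z\<close> quadratically, while the noise part rewards it only to
    first order. This applies to global optima, and, by the Rayleigh characterization of the largest
    eigenvalue, to the leading eigenvector. Normalizing the entries of a vector at most doubles its
    distance to a point of the torus, so the eigenvector estimator lies in the basin too.

  \<^item> For \<open>x\<close> in the basin, \<open>B x = (z\<^sup>* x) z + (\<Delta> + \<alpha> I) x\<close> is dominated by the multiple of
    \<open>z\<close>. Hence a step leads back to the basin (\<open>step_in_basin\<close>). The bound on the entries of
    \<open>\<Delta> z\<close> makes the domination hold in every entry: all of them have modulus at least
    \<open>3 N / 4\<close> (\<open>step_vector_component_ge\<close>).

  \<^item> On numbers of modulus at least \<open>m\<close>, normalization is Lipschitz with constant \<open>1 / m\<close>.
    Two nearby points of the torus, rotated into alignment, differ by a vector that is nearly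
    orthogonal to either of them, hence to \<open>z\<close>, so the large term \<open>z z\<^sup>*\<close> of \<open>B\<close> hardly sees
    the difference. For points \<open>x\<close>, \<open>y\<close> of the basin this bounds
    \<open>B x - B y\<close> by \<open>18 D\<close> times the distance, and \<open>18 D / (3 N / 4) \<le> 6 / 7\<close>
    (\<open>step_contraction\<close>).

  \<^item> Since \<open>B\<close> is positive semidefinite, a step increases the objective unless it is stationary,
    so every global optimum is a fixed point (\<open>global_optimum_fixed\<close>). Two fixed points of a
    contraction coincide, which makes the optimum unique up to phase, and the iterates approach it
    geometrically.
\<close>

section \<open>The Hermitian product\<close>

lemma inner_eq_Re_cinner: "inner x y = Re (cinner x y)"
  by (simp add: cinner_def inner_vec_def Re_sum inner_complex_def)

lemma cinner_add_right: "cinner u (x + y) = cinner u x + cinner u y"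
  by (simp add: cinner_def algebra_simps sum.distrib)

lemma cinner_diff_left: "cinner (x - y) u = cinner x u - cinner y u"
  by (simp add: cinner_def algebra_simps sum_subtractf)

lemma cinner_diff_right: "cinner u (x - y) = cinner u x - cinner u y"
  by (simp add: cinner_def algebra_simps sum_subtractf)

lemma cinner_scale_left: "cinner (c *s x) y = cnj c * cinner x y"
  by (simp add: cinner_def sum_distrib_left mult_ac)

lemma cinner_scale_right: "cinner x (c *s y) = c * cinner x y"
  by (simp add: cinner_def sum_distrib_left mult_ac)

lemma cinner_commute: "cinner y x = cnj (cinner x y)"
  by (simp add: cinner_def mult_ac)

lemma norm_cinner_le: "norm (cinner x y) \<le> norm x * norm y"
proof -
  have "norm (cinner x y) \<le> (\<Sum>i\<in>UNIV. \<bar>norm (x $ i)\<bar> * \<bar>norm (y $ i)\<bar>)"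
    unfolding cinner_def by (rule order_trans[OF norm_sum]) (simp add: norm_mult)
  also have "\<dots> \<le> norm x * norm y"
    unfolding norm_vec_def by (rule L2_set_mult_ineq)
  finally show ?thesis .
qed

lemma cinner_self: "cinner x x = of_real ((norm x)\<^sup>2)"
proof (rule complex_eqI)
  show "Re (cinner x x) = Re (of_real ((norm x)\<^sup>2))"
    by (simp add: inner_eq_Re_cinner[symmetric] power2_norm_eq_inner)
  show "Im (cinner x x) = Im (of_real ((norm x)\<^sup>2))"
    using cinner_commute[of x x] by (metis Im_complex_of_real Reals_cnj_iff complex_is_Real_iff)
qed

lemma norm_scale: "norm (c *s (x :: complex ^ 'n)) = norm c * norm x"
  by (simp add: norm_vec_def norm_mult L2_set_right_distrib)

lemma of_real_scale: "of_real r *s (x :: complex ^ 'n) = r *\<^sub>R x"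
  by (simp add: vec_eq_iff scaleR_conv_of_real[where 'a = complex])

lemma rotate_to_positive: obtains \<theta> where "cis \<theta> * c = of_real (norm c)"
proof
  have "c = of_real (norm c) * cis (Arg c)"
    using rcis_cmod_Arg[of c] by (simp add: rcis_def)
  then show "cis (- Arg c) * c = of_real (norm c)"
    by (metis cis_mult cis_zero add.left_inverse mult.left_commute mult.right_neutral)
qed

lemma norm_le_componentwise:
  fixes x y :: "complex ^ 'n"
  assumes "0 \<le> c" "\<And>i. norm (x $ i) \<le> c * norm (y $ i)"
  shows "norm x \<le> c * norm y"
proof -
  have "norm x \<le> norm (of_real c *s y)"
    unfolding norm_vec_def using assms by (intro L2_set_mono) (auto simp: norm_mult)
  then show ?thesis
    using assms by (simp add: norm_scale)
qed

section \<open>Hermitian matrices and their quadratic forms\<close>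

lemma linear_matrix: "linear (\<lambda>x. A *v (x :: complex ^ 'n))"
  by (rule linearI) (auto simp: matrix_vector_right_distrib vec_eq_iff matrix_vector_mult_def
      scaleR_conv_of_real[where 'a = complex] sum_distrib_left distrib_left sum.distrib mult_ac)

lemma op_norm_bound: "norm (A *v (x :: complex ^ 'n)) \<le> op_norm A * norm x"
  unfolding op_norm_def by (rule onorm) (use linear_matrix linear_conv_bounded_linear in blast)

lemma op_norm_nonneg: "0 \<le> op_norm (A :: complex ^ 'n ^ 'm)"
  unfolding op_norm_def by (rule onorm_pos_le) (use linear_matrix linear_conv_bounded_linear in blast)

lemma matrix_scale: "A *v (c *s x) = c *s (A *v (x :: complex ^ 'n))"
  by (simp add: vec_eq_iff matrix_vector_mult_def sum_distrib_left mult_ac)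

lemma norm_component_le_linf: "norm (x $ i) \<le> linf_norm x"
  unfolding linf_norm_def by (rule Max_ge) auto

lemma hermitian_self_adjoint:
  assumes "hermitian A"
  shows "inner x (A *v y) = inner (A *v x) y"
proof -
  have A: "cnj (A $ i $ j) = A $ j $ i" for i j
    using arg_cong[OF assms[unfolded hermitian_def], of "\<lambda>M. M $ j $ i"]
    by (simp add: conj_transpose_def)
  have "cinner x (A *v y) = (\<Sum>i\<in>UNIV. \<Sum>j\<in>UNIV. cnj (x $ i) * (A $ i $ j * y $ j))"
    by (simp add: cinner_def matrix_vector_mult_def sum_distrib_left)
  also have "\<dots> = (\<Sum>j\<in>UNIV. \<Sum>i\<in>UNIV. cnj (x $ i) * (A $ i $ j * y $ j))"
    by (rule sum.swap)
  also have "\<dots> = cinner (A *v x) y"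
    by (simp add: cinner_def matrix_vector_mult_def sum_distrib_left sum_distrib_right A mult_ac)
  finally show ?thesis
    by (simp add: inner_eq_Re_cinner)
qed

lemma continuous_on_quadratic_form:
  "continuous_on S (\<lambda>x :: complex ^ 'n. inner x (A *v x))"
  by (intro continuous_on_inner continuous_on_id linear_continuous_on)
     (use linear_matrix linear_conv_bounded_linear in blast)

text \<open>
  A maximizer of the quadratic form over the unit sphere is an eigenvector, and the maximum is its
  eigenvalue.
\<close>
lemma hermitian_max_eigenvector:
  fixes A :: "complex ^ 'n ^ 'n"
  assumes "hermitian A"
  obtains \<mu> u where "eigenpair A (of_real \<mu>) u" "\<And>x. inner x (A *v x) \<le> \<mu> * (norm x)\<^sup>2"
proof -
  have "sphere (0 :: complex ^ 'n) 1 \<noteq> {}"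
    by simp
  then obtain u where u: "norm u = 1"
      and max: "\<And>y. norm y = 1 \<Longrightarrow> inner y (A *v y) \<le> inner u (A *v u)"
    using continuous_attains_sup[OF compact_sphere _ continuous_on_quadratic_form, of 0 1 A]
    by (metis dist_0_norm mem_sphere)
  define \<mu> where "\<mu> = inner u (A *v u)"
  have bound: "inner x (A *v x) \<le> \<mu> * (norm x)\<^sup>2" for x
  proof (cases "x = 0")
    case False
    define y where "y = x /\<^sub>R norm x"
    have x: "x = norm x *\<^sub>R y"
      using False by (simp add: y_def)
    have "norm y = 1"
      using False by (simp add: y_def)
    then have "inner y (A *v y) \<le> \<mu>"
      unfolding \<mu>_def by (rule max)
    moreover have "inner x (A *v x) = (norm x)\<^sup>2 * inner y (A *v y)"
      by (subst (1 2) x) (simp only: linear_scale[OF linear_matrix] inner_scaleR_left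
          inner_scaleR_right power2_eq_square mult.assoc)
    ultimately show ?thesis
      by (simp add: mult.commute[of _ "(norm x)\<^sup>2"] mult_left_mono)
  qed simp
  \<comment> \<open>\<open>\<mu> I - A\<close> is a positive semidefinite form that vanishes at \<open>u\<close>, so \<open>u\<close> lies in its kernel.\<close>
  define w where "w = \<mu> *\<^sub>R u - A *v u"
  define e where "e = (norm w)\<^sup>2"
  define k where "k = \<mu> * (norm w)\<^sup>2 - inner w (A *v w)"
  have "k \<ge> 0"
    using bound[of w] by (simp add: k_def)
  \<comment> \<open>The form at \<open>u - t w\<close> is nonnegative, and its linear term in \<open>t\<close> is \<open>- 2 t e\<close>.\<close>
  have quad: "2 * t * e \<le> t\<^sup>2 * k" for t
  proof -
    have sym: "inner u (A *v w) = inner w (A *v u)"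
      using hermitian_self_adjoint[OF assms, of u w] by (simp add: inner_commute)
    have "A *v (u - t *\<^sub>R w) = A *v u - t *\<^sub>R (A *v w)"
      by (simp only: linear_diff[OF linear_matrix] linear_scale[OF linear_matrix])
    then have form: "inner (u - t *\<^sub>R w) (A *v (u - t *\<^sub>R w))
        = \<mu> - 2 * t * inner w (A *v u) + t\<^sup>2 * inner w (A *v w)"
      by (simp only: inner_diff_left inner_diff_right inner_scaleR_left inner_scaleR_right
          sym \<mu>_def power2_eq_square) (simp add: algebra_simps)
    have norm: "(norm (u - t *\<^sub>R w))\<^sup>2 = 1 - 2 * t * inner w u + t\<^sup>2 * (norm w)\<^sup>2"
      unfolding power2_norm_eq_inner using u
      by (simp add: inner_diff_left inner_diff_right
          inner_commute[of u w] power2_eq_square algebra_simps norm_eq_1)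
    have e: "e = \<mu> * inner w u - inner w (A *v u)"
      by (simp add: e_def power2_norm_eq_inner) (simp add: w_def inner_diff_right inner_diff_left)
    show ?thesis
      using bound[of "u - t *\<^sub>R w"] unfolding form norm e k_def by (simp add: algebra_simps)
  qed
  have "e = 0"
  proof (rule ccontr)
    assume "e \<noteq> 0"
    then have "e > 0"
      by (simp add: e_def)
    \<comment> \<open>Small enough that the quadratic term cannot compensate the linear one, also when \<open>k = 0\<close>.\<close>
    define t where "t = e / (k + 1)"
    have t: "t > 0"
      using \<open>e > 0\<close> \<open>k \<ge> 0\<close> by (simp add: t_def)
    have "t * (2 * e) \<le> t * (t * k)"
      using quad[of t] by (simp add: power2_eq_square mult_ac)
    then have "2 * e \<le> t * k"
      using t by simp
    also have "\<dots> \<le> t * (k + 1)"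
      using t by simp
    also have "\<dots> = e"
      using \<open>k \<ge> 0\<close> by (simp add: t_def)
    finally show False
      using \<open>e > 0\<close> by simp
  qed
  then have "A *v u = of_real \<mu> *s u"
    by (simp add: e_def w_def of_real_scale)
  moreover have "u \<noteq> 0"
    using u by auto
  ultimately show ?thesis
    using bound by (intro that[of \<mu> u]) (auto simp: eigenpair_def)
qed

text \<open>
  The definition of the largest eigenvalue compares it with other eigenvalues only. As the maximum of
  the Rayleigh quotient is one of them, it bounds the quadratic form as well.
\<close>
lemma largest_eigenvalue_rayleigh:
  assumes "hermitian A" "largest_eigenvalue A l"
  shows "inner x (A *v x) \<le> l * (norm x)\<^sup>2"
proof -
  obtain \<mu> u where "eigenpair A (of_real \<mu>) u" and *: "inner x (A *v x) \<le> \<mu> * (norm x)\<^sup>2"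
    using hermitian_max_eigenvector[OF assms(1)] by metis
  then have "\<mu> \<le> l"
    using assms(2) unfolding largest_eigenvalue_def by fastforce
  then show ?thesis
    using * by (meson mult_right_mono order_trans zero_le_power2)
qed

section \<open>Rounding to unit modulus\<close>

text \<open>
  The normalized entry is the point of the unit circle closest to the original one, so it is no
  farther from it than the entry of \<open>z\<close>. The hypothesis on \<open>x\<close> leaves its entry free where
  \<open>w\<close> vanishes; this covers the different conventions that the eigenvector estimator and the power
  method have there.
\<close>
lemma rounding_doubles_distance:
  fixes z x w :: "complex ^ 'n"
  assumes "z \<in> torus" "x \<in> torus" "\<And>i. of_real (norm (w $ i)) * x $ i = w $ i"
  shows "norm (x - z) \<le> 2 * norm (w - z)"
proof (rule norm_le_componentwise)
  fix i
  have "x $ i - w $ i = (1 - of_real (norm (w $ i))) * x $ i"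
    using assms(3)[of i] by (simp add: algebra_simps)
  also have "norm \<dots> = \<bar>norm (z $ i) - norm (w $ i)\<bar>"
  proof -
    have "(1 :: complex) - of_real (norm (w $ i)) = of_real (1 - norm (w $ i))"
      by simp
    then show ?thesis
      using assms(1,2) unfolding norm_mult torus_def by (simp del: of_real_diff)
  qed
  also have "\<dots> \<le> norm (w $ i - z $ i)"
    by (metis norm_minus_commute norm_triangle_ineq3)
  finally show "norm ((x - z) $ i) \<le> 2 * norm ((w - z) $ i)"
    using norm_triangle_ineq[of "x $ i - w $ i" "w $ i - z $ i"] by simp
qed simp

text \<open>
  With \<open>r\<close>, \<open>s\<close> the moduli and \<open>p\<close>, \<open>q\<close> the normalized numbers, the law of cosines says
  \<open>\<bar>a - b\<bar>\<^sup>2 = r s \<bar>p - q\<bar>\<^sup>2 + (r - s)\<^sup>2\<close>.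
\<close>
lemma normalization_lipschitz:
  fixes a b :: complex
  assumes "0 < m" "m \<le> norm a" "m \<le> norm b"
  shows "norm (a / of_real (norm a) - b / of_real (norm b)) \<le> norm (a - b) / m"
proof -
  define p where "p = a / of_real (norm a)"
  define q where "q = b / of_real (norm b)"
  define r where "r = norm a"
  define s where "s = norm b"
  have rs: "r > 0" "s > 0" "m \<le> r" "m \<le> s"
    using assms by (auto simp: r_def s_def)
  have a: "a = of_real r * p" and b: "b = of_real s * q"
    using rs by (auto simp: p_def q_def r_def s_def)
  have "norm p = 1" "norm q = 1"
    using rs by (auto simp: p_def q_def r_def s_def norm_divide)
  then have pq: "(Re p)\<^sup>2 + (Im p)\<^sup>2 = 1" "(Re q)\<^sup>2 + (Im q)\<^sup>2 = 1"
    by (simp_all add: cmod_def)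
  have "(norm (a - b))\<^sup>2 = r * s * (norm (p - q))\<^sup>2 + (r - s)\<^sup>2"
  proof -
    define c where "c = Re p * Re q + Im p * Im q"
    have "(norm (a - b))\<^sup>2 = r\<^sup>2 * ((Re p)\<^sup>2 + (Im p)\<^sup>2) + s\<^sup>2 * ((Re q)\<^sup>2 + (Im q)\<^sup>2)
        - 2 * r * s * c"
      unfolding a b cmod_power2 by (simp add: c_def power2_eq_square algebra_simps)
    moreover have "(norm (p - q))\<^sup>2 = ((Re p)\<^sup>2 + (Im p)\<^sup>2) + ((Re q)\<^sup>2 + (Im q)\<^sup>2)
        - 2 * c"
      unfolding cmod_power2 by (simp add: c_def power2_eq_square algebra_simps)
    ultimately have "(norm (a - b))\<^sup>2 = r\<^sup>2 + s\<^sup>2 - 2 * r * s * c" "(norm (p - q))\<^sup>2 = 2 - 2 * c"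
      by (simp_all add: pq)
    then show ?thesis
      by (simp only:) (simp add: power2_eq_square algebra_simps)
  qed
  moreover have "m\<^sup>2 * (norm (p - q))\<^sup>2 \<le> r * s * (norm (p - q))\<^sup>2"
    using rs assms by (intro mult_right_mono) (auto simp: power2_eq_square intro: mult_mono)
  ultimately have "(m * norm (p - q))\<^sup>2 \<le> (norm (a - b))\<^sup>2"
    by (smt (verit) power_mult_distrib zero_le_power2)
  then have "m * norm (p - q) \<le> norm (a - b)"
    by (rule power2_le_imp_le) simp
  then show ?thesis
    using assms(1) by (simp add: p_def q_def field_simps)
qed

section \<open>The optimization problem on the torus\<close>

lemma compact_torus: "compact (torus :: (complex ^ 'n) set)"
proof -
  have "torus = (\<Inter>i. {x :: complex ^ 'n. norm (x $ i) = 1})"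
    by (auto simp: torus_def)
  moreover have "closed {x :: complex ^ 'n. norm (x $ i) = 1}" for i
    by (intro closed_Collect_eq continuous_intros)
  ultimately have "closed (torus :: (complex ^ 'n) set)"
    by (metis (no_types, lifting) closed_INT)
  moreover have "bounded (torus :: (complex ^ 'n) set)"
  proof (rule boundedI)
    fix x :: "complex ^ 'n" assume "x \<in> torus"
    then show "norm x \<le> sqrt (real CARD('n))"
      using norm_sq_torus by (metis norm_ge_zero real_sqrt_unique order_refl)
  qed
  ultimately show ?thesis
    by (simp add: compact_eq_bounded_closed)
qed

lemma global_optima_iff:
  "x \<in> global_optima C \<longleftrightarrow>
     x \<in> torus \<and> (\<forall>y\<in>torus. inner y (C *v y) \<le> inner x (C *v x))"
  by (auto simp: global_optima_def is_arg_max_def inner_eq_Re_cinner not_less)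

lemma global_optima_nonempty: "global_optima (C :: complex ^ 'n ^ 'n) \<noteq> {}"
proof -
  have "(\<chi> i. 1) \<in> (torus :: (complex ^ 'n) set)"
    by (simp add: torus_def)
  then obtain x where "x \<in> torus" "\<forall>y\<in>torus. inner y (C *v y) \<le> inner x (C *v x)"
    using continuous_attains_sup[OF compact_torus _ continuous_on_quadratic_form[of _ C]] by blast
  then show ?thesis
    using global_optima_iff by blast
qed

lemma gpm_step_torus: "x \<in> torus \<Longrightarrow> gpm_step C \<alpha> x \<in> torus"
  by (auto simp: gpm_step_def torus_def Let_def norm_divide)

lemma gpm_step_rounds:
  "of_real (norm (((C + mat (of_real \<alpha>)) *v x) $ i)) * gpm_step C \<alpha> x $ i
     = ((C + mat (of_real \<alpha>)) *v x) $ i"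
  by (simp add: gpm_step_def Let_def)

lemma shifted_matrix: "(C + mat (of_real \<alpha>)) *v x = C *v x + \<alpha> *\<^sub>R (x :: complex ^ 'n)"
proof -
  have "mat (of_real \<alpha>) *v x = \<alpha> *\<^sub>R x"
    by (simp add: vec_eq_iff matrix_vector_mult_def mat_def if_distrib if_distribR
        scaleR_conv_of_real[where 'a = complex] cong: if_cong)
  then show ?thesis
    by (simp add: matrix_vector_mult_add_rdistrib)
qed

text \<open>
  Convexity of the form of \<open>B = C + \<alpha> I\<close> gives \<open>y\<^sup>* B y \<ge> 2 Re (y\<^sup>* B x) - x\<^sup>* B x\<close>. The step
  \<open>y\<close> from \<open>x\<close> maximizes \<open>Re (y\<^sup>* B x)\<close> over the torus, so it strictly improves the objective unless
  \<open>x\<close> is a maximizer too, and then \<open>y = x\<close>. On the torus, \<open>\<alpha> I\<close> shifts the objective by a constant.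
\<close>
lemma global_optimum_fixed:
  fixes C :: "complex ^ 'n ^ 'n"
  assumes "psd (C + mat (of_real \<alpha>))" "x \<in> global_optima C"
  shows "gpm_step C \<alpha> x = x"
proof -
  define B where "B = C + mat (of_real \<alpha>)"
  define y where "y = gpm_step C \<alpha> x"
  define w where "w = B *v x"
  have x: "x \<in> torus" and y: "y \<in> torus"
    using assms(2) by (auto simp: y_def global_optima_iff intro: gpm_step_torus)
  have form: "inner u (B *v u) = inner u (C *v u) + \<alpha> * real CARD('n)" if "u \<in> torus" for u
    unfolding B_def shifted_matrix using norm_sq_torus[OF that]
    by (simp add: inner_add_right power2_norm_eq_inner)
  have le: "inner y (B *v y) \<le> inner x (B *v x)"
    using assms(2) x y by (simp add: form global_optima_iff)
  have "0 \<le> inner (y - x) (B *v (y - x))"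
    using assms(1) by (simp add: psd_def B_def inner_eq_Re_cinner)
  moreover have "inner x (B *v y) = inner y (B *v x)"
    using hermitian_self_adjoint[of B x y] assms(1)
    by (simp add: psd_def B_def inner_commute)
  ultimately have "inner y w \<le> inner x w"
    using le by (simp add: w_def linear_diff[OF linear_matrix] inner_diff_left inner_diff_right)
  moreover have yw: "inner (y $ i) (w $ i) = norm (w $ i)" for i
  proof -
    have "w $ i = norm (w $ i) *\<^sub>R y $ i"
      using gpm_step_rounds[of C \<alpha> x i] by (simp add: w_def B_def y_def scaleR_conv_of_real[where 'a = complex])
    moreover have "inner (y $ i) (y $ i) = 1"
      using y by (simp add: torus_def norm_eq_1[symmetric])
    ultimately show ?thesis
      by (metis inner_scaleR_right mult.right_neutral)
  qed
  moreover have xw: "inner (x $ i) (w $ i) \<le> norm (w $ i)" for i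
    using norm_cauchy_schwarz[of "x $ i" "w $ i"] x by (simp add: torus_def)
  ultimately have "(\<Sum>i\<in>UNIV. norm (w $ i) - inner (x $ i) (w $ i)) \<le> 0"
    by (simp add: inner_vec_def sum_subtractf)
  then have "(\<Sum>i\<in>UNIV. norm (w $ i) - inner (x $ i) (w $ i)) = 0"
    using xw by (meson diff_ge_0_iff_ge dual_order.antisym sum_nonneg)
  then have eq: "inner (x $ i) (w $ i) = norm (w $ i)" for i
    using xw sum_nonneg_eq_0_iff[of UNIV "\<lambda>i. norm (w $ i) - inner (x $ i) (w $ i)"] by simp
  have "y $ i = x $ i" for i
  proof (cases "w $ i = 0")
    case True
    then show ?thesis
      by (simp add: y_def gpm_step_def Let_def w_def B_def)
  next
    case False
    have "inner (x $ i) (w $ i) = norm (x $ i) * norm (w $ i)"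
      using eq x by (simp add: torus_def)
    then have "norm (x $ i) *\<^sub>R w $ i = norm (w $ i) *\<^sub>R x $ i"
      by (simp add: norm_cauchy_schwarz_eq)
    moreover have "norm (w $ i) *\<^sub>R y $ i = w $ i"
      using gpm_step_rounds[of C \<alpha> x i] by (simp add: w_def B_def y_def scaleR_conv_of_real[where 'a = complex])
    ultimately have "norm (w $ i) *\<^sub>R y $ i = norm (w $ i) *\<^sub>R x $ i"
      using x by (simp add: torus_def)
    then show ?thesis
      using False by simp
  qed
  then show ?thesis
    by (simp add: y_def[symmetric] vec_eq_iff)
qed

section \<open>Rank-one matrices with small Hermitian perturbation\<close>

text \<open>
  The bound on \<open>D\<close>, which is \<open>D \<le> N powr (3 / 4) / 28\<close>, is chosen so that \<open>D * (8 * D / sqrt N)\<close>,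
  which bounds the entries of the difference of \<open>\<Delta> x\<close> and a rotation of \<open>\<Delta> z\<close> for \<open>x\<close> in
  the basin, is a small fraction of \<open>N\<close>.
\<close>
locale perturbed_rank_one =
  fixes z :: "complex ^ 'n" and \<Delta> C :: "complex ^ 'n ^ 'n" and \<alpha> D N :: real
  assumes card: "real CARD('n) = N"
    and z: "z \<in> torus"
    and herm: "hermitian \<Delta>"
    and C: "C = outer z z + \<Delta>"
    and noise: "norm (\<Delta> *v x) \<le> D * norm x"
    and D_nonneg: "0 \<le> D"
    and D_small: "D\<^sup>2 \<le> N * sqrt N / 784"
    and noise_truth: "norm ((\<Delta> *v z) $ i) \<le> N / 28"
    and shift: "0 \<le> \<alpha>" "\<alpha> \<le> D"
begin

abbreviation T :: "complex ^ 'n \<Rightarrow> complex ^ 'n" where "T \<equiv> gpm_step C \<alpha>"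

text \<open>
  The radius has to exceed \<open>6 D / sqrt N\<close>, twice the distance of the leading eigenvector, and the
  distance reached by one step, which is \<open>4 D sqrt N / \<bar>z\<^sup>* x\<bar>\<close> and hence at most
  \<open>8 D / sqrt N\<close> once \<open>\<bar>z\<^sup>* x\<bar> \<ge> N / 2\<close>.
\<close>
definition basin :: "(complex ^ 'n) set" where
  "basin = {x \<in> torus. phase_dist z x \<le> 8 * D / sqrt N}"

lemma N_ge_1: "1 \<le> N"
  using zero_less_card_finite[where 'a = 'n] card by linarith

lemma sqrt_N: "1 \<le> sqrt N" "sqrt N \<le> N" "sqrt N * sqrt N = N"
  using N_ge_1 by (auto intro: real_le_lsqrt simp: power2_eq_square)

lemma D_le: "D \<le> N / 28"
proof (rule power2_le_imp_le)
  have "D\<^sup>2 \<le> N * N / 784"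
    using D_small sqrt_N N_ge_1 by (smt (verit) divide_right_mono mult_left_mono)
  then show "D\<^sup>2 \<le> (N / 28)\<^sup>2"
    by (simp add: power2_eq_square)
qed (use N_ge_1 in simp)

lemma torus_sq: "x \<in> torus \<Longrightarrow> (norm (x :: complex ^ 'n))\<^sup>2 = N"
  by (simp add: norm_sq_torus card)

lemma norm_torus: "x \<in> torus \<Longrightarrow> norm (x :: complex ^ 'n) = sqrt N"
  using torus_sq by (metis norm_ge_zero real_sqrt_unique)

lemma C_apply: "C *v x = cinner z x *s z + \<Delta> *v x"
proof -
  have "outer z z *v x = cinner z x *s z"
    by (simp add: vec_eq_iff outer_def matrix_vector_mult_def cinner_def sum_distrib_left
        sum_distrib_right mult_ac)
  then show ?thesis
    by (simp add: C matrix_vector_mult_add_rdistrib)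
qed

lemma C_form: "inner x (C *v x) = (norm (cinner z x))\<^sup>2 + inner x (\<Delta> *v x)"
proof -
  have "cinner x (cinner z x *s z) = cinner z x * cnj (cinner z x)"
    by (simp add: cinner_scale_right cinner_commute[of x z])
  then show ?thesis
    by (simp add: C_apply inner_eq_Re_cinner cinner_add_right complex_mult_cnj cmod_power2)
qed

lemma hermitian_C: "hermitian C"
  using herm by (simp add: C hermitian_def conj_transpose_def outer_def vec_eq_iff mult.commute)

text \<open>
  Rotate \<open>x\<close> to \<open>y\<close> with \<open>a = z\<^sup>* y \<ge> 0\<close>, and let \<open>p\<close>, \<open>q\<close> be the norms of \<open>y - z\<close> and
  \<open>y + z\<close>. Then \<open>p q = 2 sqrt (N\<^sup>2 - a\<^sup>2)\<close>, and comparing objectives gives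
  \<open>N\<^sup>2 - a\<^sup>2 \<le> y\<^sup>* \<Delta> y - z\<^sup>* \<Delta> z = Re ((y - z)\<^sup>* \<Delta> (y + z)) \<le> D p q\<close>. So \<open>p q \<le> 4 D\<close>, while
  \<open>q \<ge> sqrt (2 N)\<close>.
\<close>
lemma near_truth_if_objective_ge:
  assumes "(norm x)\<^sup>2 = N" "inner z (C *v z) \<le> inner x (C *v x)"
  obtains \<theta> where "norm (cis \<theta> *s x - z) \<le> 3 * D / sqrt N"
proof -
  obtain \<theta> where \<theta>: "cis \<theta> * cinner z x = of_real (norm (cinner z x))"
    by (rule rotate_to_positive)
  define a where "a = norm (cinner z x)"
  define y where "y = cis \<theta> *s x"
  have zy: "cinner z y = of_real a"
    using \<theta> by (simp add: y_def cinner_scale_right a_def)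
  have "cnj (cis \<theta>) * cis \<theta> = 1"
    by (simp add: cis_cnj cis_mult)
  then have "inner y (C *v y) = inner x (C *v x)"
    by (simp add: y_def matrix_scale inner_eq_Re_cinner cinner_scale_left cinner_scale_right
        mult.assoc[symmetric])
  then have obj: "inner z (C *v z) \<le> inner y (C *v y)"
    using assms(2) by simp
  have a: "a \<ge> 0"
    by (simp add: a_def)
  have ny: "inner y y = N" and nz: "inner z z = N"
    using assms(1) torus_sq[OF z] by (simp_all add: y_def power2_norm_eq_inner[symmetric])
  have zy': "inner z y = a" "inner y z = a"
    using zy by (simp_all add: inner_eq_Re_cinner cinner_commute[of y z])
  define p where "p = norm (y - z)"
  define q where "q = norm (y + z)"
  have p: "p\<^sup>2 = 2 * (N - a)" and q: "q\<^sup>2 = 2 * (N + a)"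
    by (simp_all add: p_def q_def power2_norm_eq_inner inner_diff_left inner_diff_right
        inner_add_left inner_add_right ny nz zy')
  have "N\<^sup>2 - a\<^sup>2 \<le> inner y (\<Delta> *v y) - inner z (\<Delta> *v z)"
    using obj a N_ge_1 unfolding C_form zy by (simp add: cinner_self torus_sq[OF z])
  also have "\<dots> = inner (y - z) (\<Delta> *v (y + z))"
    using hermitian_self_adjoint[OF herm, of y z]
    by (simp add: matrix_vector_right_distrib inner_diff_left inner_add_right
        inner_commute[of "\<Delta> *v y" z])
  also have "\<dots> \<le> p * (D * q)"
    unfolding p_def q_def by (rule order_trans[OF norm_cauchy_schwarz mult_left_mono[OF noise]]) simp
  finally have "N\<^sup>2 - a\<^sup>2 \<le> D * (p * q)"
    by (simp add: mult_ac)
  moreover have "(p * q)\<^sup>2 = 4 * (N\<^sup>2 - a\<^sup>2)"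
    by (simp add: power_mult_distrib p q) (simp add: power2_eq_square algebra_simps)
  ultimately have "(p * q) * (p * q) \<le> 4 * D * (p * q)"
    by (simp add: power2_eq_square)
  then have pq: "p * q \<le> 4 * D"
    using D_nonneg by (smt (verit) mult_less_cancel_right)
  have "N * p\<^sup>2 \<le> 9 * D\<^sup>2"
  proof -
    have "2 * N * p\<^sup>2 \<le> q\<^sup>2 * p\<^sup>2"
      using a by (intro mult_right_mono) (simp_all add: q)
    also have "\<dots> = (p * q)\<^sup>2"
      by (simp add: power_mult_distrib)
    also have "\<dots> \<le> (4 * D)\<^sup>2"
      using pq by (intro power_mono) (auto simp: p_def q_def)
    finally have "N * p\<^sup>2 \<le> 8 * D\<^sup>2"
      by (simp add: power_mult_distrib)
    then show ?thesis
      by (rule order_trans) simp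
  qed
  then have "(p * sqrt N)\<^sup>2 \<le> (3 * D)\<^sup>2"
    using N_ge_1 by (simp add: power_mult_distrib mult.commute)
  then have "p * sqrt N \<le> 3 * D"
    by (rule power2_le_imp_le) (use D_nonneg in simp)
  then have "p \<le> 3 * D / sqrt N"
    using N_ge_1 by (simp add: field_simps)
  then show ?thesis
    by (intro that[of \<theta>]) (simp add: p_def y_def)
qed

section \<open>The basin contains the optima and the starting point\<close>

lemma global_optimum_in_basin:
  assumes "x \<in> global_optima C"
  shows "x \<in> basin"
proof -
  have x: "x \<in> torus" and "inner z (C *v z) \<le> inner x (C *v x)"
    using assms z by (auto simp: global_optima_iff)
  then obtain \<theta> where "norm (cis \<theta> *s x - z) \<le> 3 * D / sqrt N"
    using near_truth_if_objective_ge torus_sq by metis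
  also have "\<dots> \<le> 8 * D / sqrt N"
    using D_nonneg N_ge_1 by (intro divide_right_mono) auto
  finally show ?thesis
    using x phase_dist_le[of z x \<theta>] by (auto simp: basin_def)
qed

lemma eig_estimator_in_basin:
  assumes "eig_estimator C x"
  shows "x \<in> basin"
proof -
  obtain l v e where l: "largest_eigenvalue C l" and v: "eigenpair C (of_real l) v"
      "(norm v)\<^sup>2 = N" and e: "cinner e v \<noteq> 0" and x: "x = eig_round e v"
    using assms unfolding eig_estimator_def card by blast
  have "inner z (C *v z) \<le> l * N"
    using largest_eigenvalue_rayleigh[OF hermitian_C l, of z] torus_sq[OF z] by simp
  also have "\<dots> = inner v (C *v v)"
    using v by (simp add: eigenpair_def of_real_scale power2_norm_eq_inner)
  finally obtain \<theta> where \<theta>: "norm (cis \<theta> *s v - z) \<le> 3 * D / sqrt N"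
    using near_truth_if_objective_ge v(2) by blast
  have xt: "x \<in> torus"
    using e by (auto simp: x eig_round_def torus_def norm_divide)
  have rounds: "of_real (norm ((cis \<theta> *s v) $ i)) * (cis \<theta> *s x) $ i = (cis \<theta> *s v) $ i" for i
    by (simp add: x eig_round_def norm_mult)
  have "phase_dist z x \<le> norm (cis \<theta> *s x - z)"
    by (rule phase_dist_le)
  also have "\<dots> \<le> 2 * norm (cis \<theta> *s v - z)"
    by (rule rounding_doubles_distance[OF z _ rounds]) (simp add: xt)
  also have "\<dots> \<le> 2 * (3 * D / sqrt N)"
    using \<theta> by simp
  also have "\<dots> \<le> 8 * D / sqrt N"
    using D_nonneg N_ge_1 by (simp add: divide_simps)
  finally show ?thesis
    using xt by (simp add: basin_def)
qed

section \<open>The power step contracts the basin\<close>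

lemma basin_rotation:
  assumes "x \<in> basin"
  obtains c where "norm c = 1" "norm (x - c *s z) \<le> 8 * D / sqrt N"
proof -
  have x: "x \<in> torus" "phase_dist z x \<le> 8 * D / sqrt N"
    using assms by (auto simp: basin_def)
  then obtain \<theta> where "phase_dist x z = norm (cis \<theta> *s z - x)"
    using phase_dist_attained z by blast
  with x show ?thesis
    by (intro that[of "cis \<theta>"]) (simp_all add: phase_dist_commute[of x] norm_minus_commute)
qed

text \<open>
  The squared distance to the class of \<open>z\<close> is \<open>2 (N - \<bar>z\<^sup>* x\<bar>)\<close>, and on the basin it is at most
  \<open>64 D\<^sup>2 / N \<le> 64 N / 784\<close>.
\<close>
lemma basin_correlation:
  assumes "x \<in> basin"
  shows "47 / 49 * N \<le> norm (cinner z x)"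
proof -
  have x: "x \<in> torus" "phase_dist z x \<le> 8 * D / sqrt N"
    using assms by (auto simp: basin_def)
  have "norm (cinner z x) \<le> N"
    using norm_cinner_le[of z x] x(1) z N_ge_1 by (simp add: norm_torus)
  then have "2 * (N - norm (cinner z x)) = (phase_dist z x)\<^sup>2"
    using x z by (simp add: phase_dist_eq card)
  also have "\<dots> \<le> (8 * D / sqrt N)\<^sup>2"
    using x phase_dist_nonneg by (intro power_mono) auto
  also have "\<dots> = 64 * D\<^sup>2 / N"
    using N_ge_1 by (simp add: power_divide power_mult_distrib)
  also have "\<dots> \<le> 64 * (N * N / 784) / N"
  proof -
    have "D\<^sup>2 \<le> N * N / 784"
      using D_small sqrt_N N_ge_1 by (smt (verit) divide_right_mono mult_left_mono)
    then show ?thesis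
      using N_ge_1 by (intro divide_right_mono mult_left_mono) auto
  qed
  also have "\<dots> = 4 / 49 * N"
    using N_ge_1 by simp
  finally show ?thesis
    by simp
qed

lemma step_vector:
  "(C + mat (of_real \<alpha>)) *v x = cinner z x *s z + (\<Delta> *v x + \<alpha> *\<^sub>R x)"
  by (simp add: shifted_matrix C_apply)

lemma noise_shift: "norm (\<Delta> *v x + \<alpha> *\<^sub>R x) \<le> 2 * D * norm x"
proof -
  have "norm (\<Delta> *v x + \<alpha> *\<^sub>R x) \<le> D * norm x + \<alpha> * norm x"
    by (rule norm_triangle_le) (use noise[of x] shift in simp)
  also have "\<dots> \<le> D * norm x + D * norm x"
    using shift by (intro add_left_mono mult_right_mono) auto
  finally show ?thesis by simp
qed

text \<open>
  Divided by \<open>z\<^sup>* x\<close>, the vector that a step normalizes is \<open>z\<close> plus an error of norm at most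
  \<open>2 D sqrt N / \<bar>z\<^sup>* x\<bar>\<close>, and normalization at most doubles the error.
\<close>
lemma step_in_basin:
  assumes "x \<in> basin"
  shows "T x \<in> basin"
proof -
  have x: "x \<in> torus"
    using assms by (simp add: basin_def)
  define a where "a = norm (cinner z x)"
  have a: "47 / 49 * N \<le> a" "a > 0"
    using basin_correlation[OF assms] N_ge_1 by (auto simp: a_def)
  obtain \<theta> where \<theta>: "cis \<theta> * cinner z x = of_real a"
    unfolding a_def by (rule rotate_to_positive)
  define b where "b = cis \<theta> / of_real a"
  define w where "w = b *s ((C + mat (of_real \<alpha>)) *v x)"
  have nb: "norm b = 1 / a"
    using a by (simp add: b_def norm_divide)
  have rounds: "of_real (norm (w $ i)) * (cis \<theta> *s T x) $ i = w $ i" for i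
  proof -
    let ?u = "((C + mat (of_real \<alpha>)) *v x) $ i"
    have "norm (w $ i) = norm ?u / a"
      using nb by (simp add: w_def norm_mult)
    then have "of_real (norm (w $ i)) * (cis \<theta> *s T x) $ i = b * (of_real (norm ?u) * T x $ i)"
      by (simp add: b_def)
    then show ?thesis
      by (simp only: gpm_step_rounds) (simp add: w_def)
  qed
  have "w - z = b *s (\<Delta> *v x + \<alpha> *\<^sub>R x)"
  proof -
    have "b * cinner z x = 1"
      using \<theta> a by (simp add: b_def)
    then show ?thesis
      by (simp only: w_def step_vector vector_add_ldistrib vector_smult_assoc) simp
  qed
  then have "norm (w - z) \<le> 1 / a * (2 * D * sqrt N)"
    using mult_left_mono[OF noise_shift, of "1 / a" x] a x
    by (simp only: norm_scale nb norm_torus) simp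
  moreover have "phase_dist z (T x) \<le> norm (cis \<theta> *s T x - z)"
    by (rule phase_dist_le)
  moreover have "norm (cis \<theta> *s T x - z) \<le> 2 * norm (w - z)"
    by (rule rounding_doubles_distance[OF z _ rounds]) (simp add: gpm_step_torus x)
  ultimately have "phase_dist z (T x) \<le> 4 * D * sqrt N / a"
    by simp
  also have "\<dots> \<le> 4 * D * sqrt N / (N / 2)"
    using a N_ge_1 D_nonneg by (intro divide_left_mono) auto
  also have "\<dots> = 8 * D / sqrt N"
    using N_ge_1 by (simp add: field_simps)
  finally show ?thesis
    using x by (simp add: basin_def gpm_step_torus)
qed

text \<open>
  Of the modulus \<open>47 N / 49\<close> that the multiple of \<open>z\<close> contributes to an entry, \<open>\<Delta> x\<close> can cancel
  \<open>N / 28\<close> through the entry of \<open>\<Delta> z\<close> and \<open>N / 98\<close> through the distance of \<open>x\<close> to \<open>z\<close>; the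
  shift can cancel another \<open>N / 28\<close>.
\<close>
lemma step_vector_component_ge:
  assumes "x \<in> basin"
  shows "3 / 4 * N \<le> norm (((C + mat (of_real \<alpha>)) *v x) $ i)"
proof -
  have x: "x \<in> torus"
    using assms by (simp add: basin_def)
  obtain c where c: "norm c = 1" "norm (x - c *s z) \<le> 8 * D / sqrt N"
    using basin_rotation[OF assms] .
  have "\<Delta> *v x = \<Delta> *v (x - c *s z) + c *s (\<Delta> *v z)"
    by (simp add: linear_diff[OF linear_matrix] matrix_scale)
  then have "norm ((\<Delta> *v x) $ i)
      \<le> norm ((\<Delta> *v (x - c *s z)) $ i) + norm ((\<Delta> *v z) $ i)"
    using norm_triangle_ineq[of "(\<Delta> *v (x - c *s z)) $ i" "(c *s (\<Delta> *v z)) $ i"] c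
    by (simp add: norm_mult)
  also have "norm ((\<Delta> *v (x - c *s z)) $ i) \<le> D * (8 * D / sqrt N)"
    using Finite_Cartesian_Product.norm_nth_le[of "\<Delta> *v (x - c *s z)" i] noise[of "x - c *s z"]
      mult_left_mono[OF c(2) D_nonneg] by linarith
  also have "D * (8 * D / sqrt N) \<le> N / 98"
    using D_small N_ge_1 by (simp add: field_simps power2_eq_square)
  finally have 1: "norm ((\<Delta> *v x) $ i) \<le> N / 98 + N / 28"
    using noise_truth[of i] by simp
  have 2: "norm ((\<alpha> *\<^sub>R x) $ i) \<le> N / 28"
    using x shift D_le by (simp add: torus_def)
  have 3: "47 / 49 * N \<le> norm ((cinner z x *s z) $ i)"
    using basin_correlation[OF assms] z by (simp add: norm_mult torus_def)
  have "norm ((cinner z x *s z) $ i) \<le> norm (((C + mat (of_real \<alpha>)) *v x) $ i)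
      + (norm ((\<Delta> *v x) $ i) + norm ((\<alpha> *\<^sub>R x) $ i))"
    using norm_triangle_ineq4[of "((C + mat (of_real \<alpha>)) *v x) $ i" "(\<Delta> *v x + \<alpha> *\<^sub>R x) $ i"]
      norm_triangle_ineq[of "(\<Delta> *v x) $ i" "(\<alpha> *\<^sub>R x) $ i"]
    by (simp add: step_vector)
  with 1 2 3 show ?thesis
    using N_ge_1 by (simp add: field_simps)
qed

text \<open>
  Points at distance \<open>d\<close> on a sphere, rotated so that \<open>x\<^sup>* y \<ge> 0\<close>, satisfy
  \<open>x\<^sup>* (x - y) = d\<^sup>2 / 2\<close>: their difference is orthogonal to \<open>x\<close> up to second order. Replacing
  \<open>x\<close> by a rotation of the nearby \<open>z\<close> costs \<open>8 D / sqrt N\<close> times \<open>d\<close>.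
\<close>
lemma truth_correlation_lipschitz:
  assumes "x \<in> basin" "y \<in> torus" "cinner x y = of_real (norm (cinner x y))"
    and "norm (x - y) \<le> 16 * D / sqrt N"
  shows "norm (cinner z (x - y)) \<le> 16 * D / sqrt N * norm (x - y)"
proof -
  have x: "x \<in> torus"
    using assms by (simp add: basin_def)
  obtain c where c: "norm c = 1" "norm (x - c *s z) \<le> 8 * D / sqrt N"
    using basin_rotation[OF assms(1)] .
  have half: "norm (cinner x (x - y)) = norm (x - y) * norm (x - y) / 2"
  proof -
    define r where "r = norm (cinner x y)"
    have r: "cinner x y = of_real r"
      using assms(3) by (simp add: r_def)
    have "r \<le> N"
      using norm_cinner_le[of x y] assms(2) x N_ge_1 by (simp add: norm_torus r_def)
    have "(norm (x - y))\<^sup>2 = 2 * (N - r)"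
      using norm_phase_diff_sq[OF x assms(2), of 0] r by (simp add: card norm_minus_commute)
    moreover have "cinner x (x - y) = of_real (N - r)"
      by (simp add: cinner_diff_right cinner_self torus_sq[OF x] r)
    ultimately show ?thesis
      using \<open>r \<le> N\<close> by (simp add: power2_eq_square del: of_real_diff)
  qed
  have "norm (cinner z (x - y)) = norm (cinner (c *s z) (x - y))"
    using c by (simp add: cinner_scale_left norm_mult)
  also have "cinner (c *s z) (x - y) = cinner x (x - y) - cinner (x - c *s z) (x - y)"
    by (simp add: cinner_diff_left)
  also have "norm \<dots> \<le> norm (cinner x (x - y)) + norm (cinner (x - c *s z) (x - y))"
    by (rule norm_triangle_ineq4)
  also have "\<dots> \<le> norm (x - y) * norm (x - y) / 2 + norm (x - c *s z) * norm (x - y)"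
    using norm_cinner_le[of "x - c *s z" "x - y"] half by simp
  also have "\<dots> = (norm (x - y) / 2 + norm (x - c *s z)) * norm (x - y)"
    by (simp add: algebra_simps)
  also have "\<dots> \<le> 16 * D / sqrt N * norm (x - y)"
    using assms(4) c(2) by (intro mult_right_mono) auto
  finally show ?thesis .
qed

text \<open>
  The rank-one part of \<open>C\<close> contributes \<open>16 D\<close> (its factor \<open>z\<close> has norm \<open>sqrt N\<close>) and
  \<open>\<Delta> + \<alpha> I\<close> contributes \<open>2 D\<close> to the Lipschitz constant before normalization, which divides by
  \<open>3 N / 4\<close>.
\<close>
lemma step_contraction:
  assumes "x \<in> basin" "y \<in> basin"
  shows "phase_dist (T x) (T y) \<le> 6 / 7 * phase_dist x y"
proof -
  have t: "x \<in> torus" "y \<in> torus"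
    using assms by (auto simp: basin_def)
  obtain \<theta> where \<theta>: "cis \<theta> * cinner x y = of_real (norm (cinner x y))"
    by (rule rotate_to_positive)
  define y' where "y' = cis \<theta> *s y"
  have y': "y' \<in> torus" "cinner x y' = of_real (norm (cinner x y'))"
    using t \<theta> by (simp_all add: y'_def cinner_scale_right norm_mult)
  have dist: "norm (x - y') = phase_dist x y"
  proof -
    have "(norm (x - y'))\<^sup>2 = 2 * (N - norm (cinner x y))"
      using norm_phase_diff_sq[OF t, of \<theta>] \<theta> by (simp add: card y'_def norm_minus_commute)
    then show ?thesis
      using phase_dist_eq[OF t, unfolded card] by (metis norm_ge_zero real_sqrt_unique)
  qed
  \<comment> \<open>Both points are within the basin radius of the class of \<open>z\<close>.\<close>
  have close: "norm (x - y') \<le> 16 * D / sqrt N"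
    using phase_dist_triangle[OF t(1) z t(2)] assms
    by (simp add: dist basin_def phase_dist_commute[of x z])
  let ?w = "\<lambda>x. (C + mat (of_real \<alpha>)) *v x"
  \<comment> \<open>The step commutes with rotations, so \<open>T y\<close> may be compared after rotating \<open>y\<close> towards \<open>x\<close>.\<close>
  have wy: "?w y' = cis \<theta> *s ?w y"
    by (simp add: y'_def matrix_scale)
  have step: "T u $ i = ?w u $ i / of_real (norm (?w u $ i))" if "u \<in> basin" for u i
  proof -
    have "?w u $ i \<noteq> 0"
      using step_vector_component_ge[OF that, of i] N_ge_1 by auto
    then show ?thesis
      by (simp add: gpm_step_def Let_def)
  qed
  have "phase_dist (T x) (T y) \<le> norm (cis \<theta> *s T y - T x)"
    by (rule phase_dist_le)
  also have "\<dots> \<le> 4 / (3 * N) * norm (?w y' - ?w x)"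
  proof (rule norm_le_componentwise)
    fix i
    have "(cis \<theta> *s T y - T x) $ i
        = ?w y' $ i / of_real (norm (?w y' $ i)) - ?w x $ i / of_real (norm (?w x $ i))"
      by (simp add: step assms wy norm_mult)
    also have "norm \<dots> \<le> norm (?w y' $ i - ?w x $ i) / (3 / 4 * N)"
      by (rule normalization_lipschitz)
         (use N_ge_1 step_vector_component_ge[OF assms(1)] step_vector_component_ge[OF assms(2)]
          in \<open>simp_all add: wy norm_mult\<close>)
    finally show "norm ((cis \<theta> *s T y - T x) $ i) \<le> 4 / (3 * N) * norm ((?w y' - ?w x) $ i)"
      by simp
  qed (use N_ge_1 in simp)
  also have "\<dots> \<le> 4 / (3 * N) * (18 * D * norm (x - y'))"
  proof -
    have "norm (?w y' - ?w x) = norm (?w (x - y'))"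
      by (simp add: linear_diff[OF linear_matrix] norm_minus_commute)
    also have "\<dots> \<le> norm (cinner z (x - y') *s z) + norm (\<Delta> *v (x - y') + \<alpha> *\<^sub>R (x - y'))"
      unfolding step_vector by (rule norm_triangle_ineq)
    also have "\<dots> \<le> 16 * D / sqrt N * norm (x - y') * sqrt N + 2 * D * norm (x - y')"
      using truth_correlation_lipschitz[OF assms(1) y' close]
      unfolding norm_scale norm_torus[OF z]
      by (intro add_mono noise_shift mult_right_mono) (use N_ge_1 in auto)
    also have "\<dots> = 18 * D * norm (x - y')"
      using N_ge_1 by (simp add: field_simps)
    finally show ?thesis
      using N_ge_1 by (intro mult_left_mono) auto
  qed
  also have "4 / (3 * N) * (18 * D * norm (x - y')) \<le> 6 / 7 * norm (x - y')"
  proof -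
    have "4 / (3 * N) * (18 * D) \<le> 6 / 7"
      using D_le N_ge_1 by (simp add: field_simps)
    then show ?thesis
      using mult_right_mono[of "4 / (3 * N) * (18 * D)" "6 / 7" "norm (x - y')"]
      by (simp only: mult.assoc norm_ge_zero)
  qed
  finally show ?thesis
    by (simp only: dist)
qed

section \<open>Fixed points and iterates\<close>

lemma iterates_in_basin: "x \<in> basin \<Longrightarrow> gpm C \<alpha> x k \<in> basin"
  by (induction k) (simp_all add: gpm_def step_in_basin)

lemma iterates_converge_linearly:
  assumes "psd (C + mat (of_real \<alpha>))" "xopt \<in> global_optima C" "x \<in> basin"
  shows "phase_dist xopt (gpm C \<alpha> x k) \<le> (6 / 7) ^ k * phase_dist xopt x"
proof (induction k)
  case (Suc k)
  have "phase_dist (T xopt) (T (gpm C \<alpha> x k)) \<le> 6 / 7 * phase_dist xopt (gpm C \<alpha> x k)"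
    by (intro step_contraction global_optimum_in_basin[OF assms(2)] iterates_in_basin[OF assms(3)])
  then show ?case
    using Suc global_optimum_fixed[OF assms(1,2)] by (simp add: gpm_def)
qed (simp add: gpm_def)

lemma global_optima_class:
  assumes "psd (C + mat (of_real \<alpha>))" "x \<in> global_optima C"
  shows "global_optima C = phase_rel `` {x}"
proof (rule set_eqI)
  fix y
  have x: "x \<in> torus"
    using assms by (simp add: global_optima_iff)
  show "y \<in> global_optima C \<longleftrightarrow> y \<in> phase_rel `` {x}"
  proof
    assume y: "y \<in> global_optima C"
    have "phase_dist (T x) (T y) \<le> 6 / 7 * phase_dist x y"
      using assms y by (intro step_contraction global_optimum_in_basin)
    then have "phase_dist x y = 0"
      using phase_dist_nonneg[of x y] by (simp add: global_optimum_fixed[OF assms(1)] assms y)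
    then show "y \<in> phase_rel `` {x}"
      using x y by (simp add: phase_dist_zero_iff global_optima_iff)
  next
    assume "y \<in> phase_rel `` {x}"
    then obtain \<theta> where y: "y \<in> torus" "x = cis \<theta> *s y"
      by (auto simp: phase_rel_def)
    have "cnj (cis \<theta>) * cis \<theta> = 1"
      by (simp add: cis_cnj cis_mult)
    then have "inner x (C *v x) = inner y (C *v y)"
      by (simp add: y(2) matrix_scale inner_eq_Re_cinner cinner_scale_left cinner_scale_right
          mult.assoc[symmetric])
    then show "y \<in> global_optima C"
      using assms(2) y(1) by (simp add: global_optima_iff)
  qed
qed

end

section \<open>Convergence of the generalized power method\<close>

text \<open>
  This turns the factor \<open>sqrt (ln N)\<close> of the entrywise noise bound into \<open>N powr (1 / 3)\<close>, which
  raises \<open>N powr (2 / 3)\<close> to \<open>N\<close>.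
\<close>
lemma ln_le_powr_two_thirds:
  assumes "1 \<le> (x :: real)"
  shows "ln x \<le> (x powr (1 / 3))\<^sup>2"
proof -
  define t where "t = x powr (1 / 3)"
  have "ln x = 3 * ln t"
    using assms by (simp add: t_def ln_powr)
  also have "\<dots> \<le> 3 * (t - 1)"
    using assms by (intro mult_left_mono ln_le_minus_one) (auto simp: t_def)
  also have "\<dots> \<le> t\<^sup>2"
    using zero_le_power2[of "t - 3 / 2"] by (simp add: power2_eq_square algebra_simps)
  finally show ?thesis
    by (simp add: t_def)
qed

theorem theorem3:
  fixes z :: "complex ^ 'n"
    and \<Delta> C :: "complex ^ 'n ^ 'n"
    and \<alpha> :: real
    and x0 :: "complex ^ 'n"
  assumes "z \<in> torus"
    and "hermitian \<Delta>"
    and "C = outer z z + \<Delta>"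
    and "op_norm \<Delta> \<le> 1 / 28 * real CARD('n) powr (2 / 3)"
    and "linf_norm (\<Delta> *v z) \<le> 1 / 28 * real CARD('n) powr (2 / 3) * sqrt (ln (real CARD('n)))"
    and "\<alpha> \<ge> 0"
    and "psd (C + mat (of_real \<alpha>))"
    and "\<alpha> \<le> op_norm \<Delta>"
    and "eig_estimator C x0"
  shows "global_optima C \<in> torus // phase_rel
    \<and> limitin quot_topology (\<lambda>k. phase_rel `` {gpm C \<alpha> x0 k}) (global_optima C) sequentially
    \<and> (\<forall>xopt \<in> global_optima C. (\<lambda>k. phase_dist xopt (gpm C \<alpha> x0 k)) \<longlonglongrightarrow> 0)"
proof -
  define N where "N = real CARD('n)"
  have N: "1 \<le> N"
    using zero_less_card_finite[where 'a = 'n] unfolding N_def by linarith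
  have D: "(op_norm \<Delta>)\<^sup>2 \<le> N * sqrt N / 784"
  proof -
    have "(op_norm \<Delta>)\<^sup>2 \<le> (1 / 28 * N powr (2 / 3))\<^sup>2"
      using assms(4) op_norm_nonneg unfolding N_def by (intro power_mono) auto
    also have "\<dots> = N powr (4 / 3) / 784"
      using N by (simp add: power2_eq_square powr_add[symmetric])
    also have "\<dots> \<le> N powr (1 + 1 / 2) / 784"
      using N by (intro divide_right_mono powr_mono) auto
    also have "\<dots> = N * sqrt N / 784"
      using N by (subst powr_add) (simp add: powr_half_sqrt)
    finally show ?thesis .
  qed
  have linf: "norm ((\<Delta> *v z) $ i) \<le> N / 28" for i
  proof -
    have "sqrt (ln N) \<le> N powr (1 / 3)"
      using ln_le_powr_two_thirds[OF N] by (intro real_le_lsqrt) auto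
    then have "1 / 28 * N powr (2 / 3) * sqrt (ln N) \<le> 1 / 28 * N powr (2 / 3) * N powr (1 / 3)"
      by (intro mult_left_mono) auto
    also have "\<dots> = N / 28"
      using N by (simp add: powr_add[symmetric])
    finally show ?thesis
      using norm_component_le_linf[of "\<Delta> *v z" i] assms(5) by (simp add: N_def)
  qed
  interpret perturbed_rank_one z \<Delta> C \<alpha> "op_norm \<Delta>" N
    by unfold_locales
       (use assms D linf op_norm_nonneg in \<open>auto simp: N_def[symmetric] op_norm_bound\<close>)
  have x0: "x0 \<in> basin"
    by (rule eig_estimator_in_basin) fact
  obtain x where x: "x \<in> global_optima C"
    using global_optima_nonempty by blast
  have xt: "x \<in> torus"
    using x by (simp add: global_optima_iff)
  have optima: "global_optima C = phase_rel `` {x}"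
    using assms(7) x by (rule global_optima_class)
  have conv: "(\<lambda>k. phase_dist xopt (gpm C \<alpha> x0 k)) \<longlonglongrightarrow> 0" if "xopt \<in> global_optima C" for xopt
  proof (rule tendsto_sandwich)
    show "\<forall>\<^sub>F k in sequentially. 0 \<le> phase_dist xopt (gpm C \<alpha> x0 k)"
      by (simp add: phase_dist_nonneg)
    show "\<forall>\<^sub>F k in sequentially. phase_dist xopt (gpm C \<alpha> x0 k) \<le> (6 / 7) ^ k * phase_dist xopt x0"
      using iterates_converge_linearly[OF assms(7) that x0] by simp
    show "(\<lambda>k. (6 / 7) ^ k * phase_dist xopt x0) \<longlonglongrightarrow> 0"
      by (intro tendsto_mult_left_zero LIMSEQ_power_zero) simp
  qed simp
  have quot: "global_optima C \<in> torus // phase_rel"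
    unfolding optima by (rule quotientI) (rule xt)
  have gt: "gpm C \<alpha> x0 k \<in> torus" for k
    using iterates_in_basin[OF x0] by (simp add: basin_def)
  have "limitin quot_topology (\<lambda>k. phase_rel `` {gpm C \<alpha> x0 k}) (global_optima C) sequentially"
    unfolding quot_topology_def Metric_space.limitin_metric_dist_null[OF Metric_space_quot]
  proof (intro conjI quot)
    show "\<forall>\<^sub>F k in sequentially. phase_rel `` {gpm C \<alpha> x0 k} \<in> torus // phase_rel"
      using gt by (simp add: quotientI)
    show "(\<lambda>k. quot_dist (phase_rel `` {gpm C \<alpha> x0 k}) (global_optima C)) \<longlonglongrightarrow> 0"
      unfolding optima quot_dist_class[OF gt xt] phase_dist_commute[of _ x]
      by (rule conv) (rule x)
  qed
  with quot conv show ?thesis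
    by blast
qed

end
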